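(* Let $n\ge k>a\ge 0$ be integers. If $n\geq k\left(\left\lceil\frac{k-a}{a+1}\right\rceil+2\right)$ and $k-2\ge a$, then $B(K(n,k,a))=\left\lceil\frac{k-a}{a+1}\right\rceil+2$.
   Context: All graphs are finite, undirected, without loops or multiple edges. In a zero forcing process, the vertices of a graph are initially colored black or white; whenever there is a black vertex adjacent to exactly one white vertex, that white vertex is forced to become black, and this is repeated as long as possible. An initial set of black vertices is a zero forcing set if eventually all vertices of the graph become black; otherwise it is a failed zero forcing set, and its complement (the initial set of white vertices) is called a zero blocking set. The zero blocking number $B(G)$ of $G$ is the minimum size of a zero blocking set of $G$. Let $[n]=\{1,2,\ldots,n\}$. For integers $n\ge k>a\ge 0$, the generalized Kneser graph $K(n,k,a)$ is the graph whose vertices are the $k$-subsets of $[n]$, where two (distinct) vertices $A$ and $B$ are adjacent if and only if $|A\cap B|\le a$. *)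

theory Defs
  imports Complex_Main "Graph_Theory.Pair_Digraph"
begin

text \<open>
  A finite simple undirected graph is a \<^locale>\<open>pair_graph\<close>: both orientations of
  every edge are arcs. Sets \<open>S\<close> below are the currently black vertices.
\<close>

inductive force_step :: "'a pair_pre_digraph \<Rightarrow> 'a set \<Rightarrow> 'a set \<Rightarrow> bool"
  for G :: "'a pair_pre_digraph"
  where "u \<in> S \<Longrightarrow> {w \<in> pverts G - S. (u, w) \<in> parcs G} = {v} \<Longrightarrow> force_step G S (insert v S)"

text \<open>
  Forces are performed one at a time. By \<open>force_final_unique\<close> below the final set does
  not depend on the order, so asking for one run that blackens every vertex is the same as
  asking it of every run that is continued as long as possible.
\<close>

definition zero_forcing_set :: "'a pair_pre_digraph \<Rightarrow> 'a set \<Rightarrow> bool" where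
  "zero_forcing_set G S \<longleftrightarrow> S \<subseteq> pverts G \<and> (force_step G)\<^sup>*\<^sup>* S (pverts G)"

definition failed_zero_forcing_set :: "'a pair_pre_digraph \<Rightarrow> 'a set \<Rightarrow> bool" where
  "failed_zero_forcing_set G S \<longleftrightarrow> S \<subseteq> pverts G \<and> \<not> zero_forcing_set G S"

definition zero_blocking_set :: "'a pair_pre_digraph \<Rightarrow> 'a set \<Rightarrow> bool" where
  "zero_blocking_set G W \<longleftrightarrow> W \<subseteq> pverts G \<and> failed_zero_forcing_set G (pverts G - W)"

text \<open>
  Meaningful for graphs with at least one vertex; the null graph has no zero blocking set.
\<close>

definition zero_blocking_number :: "'a pair_pre_digraph \<Rightarrow> nat" where
  "zero_blocking_number G = (LEAST b. \<exists>W. zero_blocking_set G W \<and> card W = b)"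

text \<open>
  The condition \<open>A \<noteq> B\<close> is implied by \<open>card (A \<inter> B) \<le> a\<close> when \<open>a < k\<close>.
\<close>

definition gen_kneser_graph :: "nat \<Rightarrow> nat \<Rightarrow> nat \<Rightarrow> nat set pair_pre_digraph" where
  "gen_kneser_graph n k a =
    \<lparr> pverts = {A. A \<subseteq> {1..n} \<and> card A = k},
      parcs = {(A, B). A \<subseteq> {1..n} \<and> card A = k \<and> B \<subseteq> {1..n} \<and> card B = k
                 \<and> A \<noteq> B \<and> card (A \<inter> B) \<le> a} \<rparr>"

lemma force_step_mono_final:
  assumes "(force_step G)\<^sup>*\<^sup>* S T" "(force_step G)\<^sup>*\<^sup>* S U" "\<And>V. \<not> force_step G U V"
  shows "T \<subseteq> U"
  using assms(1)
proof (induction rule: rtranclp_induct)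
  case base
  from assms(2) show ?case
    by (induction rule: rtranclp_induct) (auto elim: force_step.cases)
next
  case (step T T')
  from step.hyps(2) obtain u v where uv: "u \<in> T" "T' = insert v T"
    and eq: "{w \<in> pverts G - T. (u, w) \<in> parcs G} = {v}"
    by (auto elim: force_step.cases)
  have "v \<in> U"
  proof (rule ccontr)
    assume "v \<notin> U"
    then have "{w \<in> pverts G - U. (u, w) \<in> parcs G} = {v}"
      using eq step.IH by blast
    then have "force_step G U (insert v U)"
      using uv step.IH by (auto intro: force_step.intros)
    then show False using assms(3) by blast
  qed
  then show ?case using uv step.IH by auto
qed

lemma force_final_unique:
  assumes "(force_step G)\<^sup>*\<^sup>* S T" "\<And>V. \<not> force_step G T V"
    and "(force_step G)\<^sup>*\<^sup>* S U" "\<And>V. \<not> force_step G U V"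
  shows "T = U"
  using assms by (intro subset_antisym force_step_mono_final)

lemma zero_blocking_set_pverts:
  assumes "pverts G \<noteq> {}"
  shows "zero_blocking_set G (pverts G)"
proof -
  have "T = {}" if "(force_step G)\<^sup>*\<^sup>* {} T" for T
    using that by (induction rule: rtranclp_induct) (auto elim: force_step.cases)
  then show ?thesis
    using assms unfolding zero_blocking_set_def failed_zero_forcing_set_def zero_forcing_set_def
    by auto
qed

lemma pair_graph_gen_kneser: "pair_graph (gen_kneser_graph n k a)"
proof -
  let ?G = "gen_kneser_graph n k a"
  have "pverts ?G \<subseteq> Pow {1..n}"
    by (auto simp: gen_kneser_graph_def)
  then have fv: "finite (pverts ?G)"
    by (rule finite_subset) simp
  have sub: "parcs ?G \<subseteq> pverts ?G \<times> pverts ?G"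
    by (auto simp: gen_kneser_graph_def)
  then have fa: "finite (parcs ?G)"
    by (rule finite_subset) (simp add: fv)
  have ends: "fst e \<in> pverts ?G" "snd e \<in> pverts ?G" if "e \<in> parcs ?G" for e
    using subsetD[OF sub that] by (simp_all add: mem_Times_iff)
  have loop: "fst e \<noteq> snd e" if "e \<in> parcs ?G" for e
    using that by (cases e) (simp add: gen_kneser_graph_def)
  have "(B, A) \<in> parcs ?G" if "(A, B) \<in> parcs ?G" for A B
    using that by (simp add: gen_kneser_graph_def Int_commute[of B A] eq_commute[of B A])
  then have sym: "symmetric ?G"
    by (simp add: symmetric_def sym_def)
  show ?thesis
    by unfold_locales (fact fv fa ends loop sym)+
qed

end

theory Submission
  imports Defs
begin

text \<open>
  Write \<open>q = k div (a + 1)\<close>, which is the ceiling in the statement. Blocking sets of minimum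
  size are \<open>stalled\<close>: no vertex outside has exactly one neighbour inside.

  A \<open>k\<close>-set meets at most \<open>q\<close> of \<open>q + 2\<close> pairwise disjoint \<open>k\<close>-sets in more than \<open>a\<close> points,
  so it is adjacent to at least two of them, and these \<open>k\<close>-sets form a stalled set.

  Conversely, let \<open>W\<close> consist of at most \<open>q + 1\<close> vertices and let \<open>F \<in> W\<close>. Delete from \<open>F\<close>
  one point of \<open>F - A\<close> for each other \<open>A \<in> W\<close>; at least \<open>k - q \<ge> a\<close> points remain, of which
  \<open>D\<close> collects \<open>a\<close>. As \<open>D\<close> does not contain \<open>F - A\<close>, each \<open>A\<close> has \<open>a + 1\<close> points in
  \<open>D \<union> (A - F)\<close>. The at most \<open>q (a + 1) \<le> k\<close> points chosen in this way, filled up outside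
  \<open>\<Union>W\<close>, give a vertex whose only neighbour in \<open>W\<close> is \<open>F\<close>.
\<close>

section \<open>Stalled sets, also known as forts, and zero blocking sets\<close>

definition stalled :: "'a pair_pre_digraph \<Rightarrow> 'a set \<Rightarrow> bool" where
  "stalled G W \<longleftrightarrow> W \<subseteq> pverts G \<and> W \<noteq> {} \<and>
     (\<forall>u \<in> pverts G - W. card {w \<in> W. (u, w) \<in> parcs G} \<noteq> 1)"

lemma stalled_imp_zero_blocking_set:
  assumes "stalled G W"
  shows "zero_blocking_set G W"
proof -
  have sub: "W \<subseteq> pverts G" and ne: "W \<noteq> {}"
    and st: "\<And>u. u \<in> pverts G - W \<Longrightarrow> card {w \<in> W. (u, w) \<in> parcs G} \<noteq> 1"
    using assms by (auto simp: stalled_def)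
  have eq: "pverts G - (pverts G - W) = W"
    using sub by blast
  have no_step: "\<not> force_step G (pverts G - W) S" for S
  proof
    assume "force_step G (pverts G - W) S"
    then obtain u v where "u \<in> pverts G - W" "{w \<in> W. (u, w) \<in> parcs G} = {v}"
      by (auto elim!: force_step.cases simp: eq)
    then show False
      using st[of u] by simp
  qed
  have "S = pverts G - W" if "(force_step G)\<^sup>*\<^sup>* (pverts G - W) S" for S
    using that no_step by (metis converse_rtranclpE)
  moreover have "pverts G \<noteq> pverts G - W"
    using sub ne by blast
  ultimately show ?thesis
    using sub by (auto simp: zero_blocking_set_def failed_zero_forcing_set_def zero_forcing_set_def)
qed

text \<open>If \<open>W\<close> is not stalled, some \<open>v\<close> in \<open>W\<close> can be
  forced at once, and \<open>W - {v}\<close> still blocks: forcing everything from its complement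
  would force everything from that of \<open>W\<close>. The descent stops because the empty set does
  not block.\<close>

lemma zero_blocking_set_imp_stalled_subset:
  assumes "finite W" and "zero_blocking_set G W"
  shows "\<exists>U \<subseteq> W. stalled G U"
  using assms
proof (induction W rule: finite_psubset_induct)
  case (psubset W)
  have sub: "W \<subseteq> pverts G"
    and fail: "\<not> (force_step G)\<^sup>*\<^sup>* (pverts G - W) (pverts G)"
    using psubset.prems
    by (auto simp: zero_blocking_set_def failed_zero_forcing_set_def zero_forcing_set_def)
  have ne: "W \<noteq> {}"
    using fail by auto
  have eq: "pverts G - (pverts G - W) = W"
    using sub by blast
  show ?case
  proof (cases "stalled G W")
    case False
    then obtain u where u: "u \<in> pverts G - W" "card {w \<in> W. (u, w) \<in> parcs G} = 1"
      using sub ne by (auto simp: stalled_def)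
    then obtain v where v: "{w \<in> W. (u, w) \<in> parcs G} = {v}"
      by (meson card_1_singletonE)
    then have "v \<in> W" by blast
    have "force_step G (pverts G - W) (insert v (pverts G - W))"
      using u v by (intro force_step.intros[of u]) (auto simp: eq)
    moreover have "insert v (pverts G - W) = pverts G - (W - {v})"
      using \<open>v \<in> W\<close> sub by blast
    ultimately have "\<not> (force_step G)\<^sup>*\<^sup>* (pverts G - (W - {v})) (pverts G)"
      using fail by (metis converse_rtranclp_into_rtranclp)
    then have "zero_blocking_set G (W - {v})"
      using sub
      by (auto simp: zero_blocking_set_def failed_zero_forcing_set_def zero_forcing_set_def)
    moreover have "W - {v} \<subset> W"
      using \<open>v \<in> W\<close> by blast
    ultimately obtain U where "U \<subseteq> W - {v}" "stalled G U"
      using psubset.IH[of "W - {v}"] by auto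
    then show ?thesis
      by blast
  next
    case True
    then show ?thesis by blast
  qed
qed

text \<open>As each zero blocking set contains a stalled one, the minimum may be taken over stalled
  sets alone.\<close>

lemma zero_blocking_number_eqI:
  assumes "finite (pverts G)" and "stalled G W" and "\<And>U. stalled G U \<Longrightarrow> card W \<le> card U"
  shows "zero_blocking_number G = card W"
  unfolding zero_blocking_number_def
proof (rule Least_equality)
  show "\<exists>V. zero_blocking_set G V \<and> card V = card W"
    using stalled_imp_zero_blocking_set[OF assms(2)] by blast
next
  fix b
  assume "\<exists>V. zero_blocking_set G V \<and> card V = b"
  then obtain V where V: "zero_blocking_set G V" "card V = b" by blast
  then have fin: "finite V"
    using assms(1) finite_subset by (auto simp: zero_blocking_set_def)
  then obtain U where "U \<subseteq> V" "stalled G U"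
    using zero_blocking_set_imp_stalled_subset V by blast
  then show "card W \<le> b"
    using assms(3)[of U] card_mono[OF fin, of U] V by simp
qed

section \<open>Sets that meet all members of a family but one in many points\<close>

lemma exists_large_subsets_in_common_core:
  assumes W: "\<forall>A \<in> W. finite A \<and> card A = k" "finite W"
    and F: "F \<in> W" and le: "a + card (W - {F}) \<le> k"
  obtains D T where "D \<subseteq> F" "card D = a"
    "\<forall>A \<in> W - {F}. T A \<subseteq> A \<and> card (T A) = a + 1 \<and> T A \<inter> F \<subseteq> D"
proof -
  have finF: "finite F" "card F = k"
    using bspec[OF W(1) F] by auto
  have ne: "F - A \<noteq> {}" if "A \<in> W - {F}" for A
    using that bspec[OF W(1), of A] finF card_subset_eq[of A F] by auto
  define x where "x A = (SOME y. y \<in> F - A)" for A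
  have x: "x A \<in> F - A" if "A \<in> W - {F}" for A
    using ne[OF that] unfolding x_def by (rule some_in_eq[THEN iffD2])
  have "card (x ` (W - {F})) \<le> card (W - {F})"
    using W(2) by (intro card_image_le) auto
  then have "a \<le> card (F - x ` (W - {F}))"
    using le finF diff_card_le_card_Diff[of "x ` (W - {F})" F] W(2) by simp
  then obtain D where D: "D \<subseteq> F - x ` (W - {F})" "card D = a"
    by (meson obtain_subset_with_card_n)
  have "\<exists>T. T \<subseteq> A \<and> card T = a + 1 \<and> T \<inter> F \<subseteq> D" if A: "A \<in> W - {F}" for A
  proof -
    have finA: "finite A" "card A = k"
      using W(1) A by auto
    have finD: "finite D"
      using D finF finite_subset by blast
    \<comment> \<open>The point \<open>x A\<close> of \<open>F - A\<close> was removed before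
      \<open>D\<close> was chosen, so the inclusion is strict.\<close>
    have "D - A \<subset> F - A"
      using D x[OF A] A by blast
    then have less: "card (D - A) < card (F - A)"
      using finF by (intro psubset_card_mono) auto
    have "card (D \<inter> A) + card (D - A) = a"
      using D finD card_Int_Diff by metis
    \<comment> \<open>Since \<open>F\<close> and \<open>A\<close> have the same size,
      \<open>A - F\<close> more than makes up for the points lost from \<open>D\<close> to
      \<open>D \<inter> A\<close>.\<close>
    moreover have "card (F - A) = card (A - F)"
      using finA finF card_Int_Diff[of A F] card_Int_Diff[of F A] by (simp add: Int_commute)
    moreover have "card ((D \<inter> A) \<union> (A - F)) = card (D \<inter> A) + card (A - F)"
      using D finA finD by (intro card_Un_disjoint) auto
    ultimately have "a + 1 \<le> card ((D \<inter> A) \<union> (A - F))"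
      using less by linarith
    then obtain T where "T \<subseteq> (D \<inter> A) \<union> (A - F)" "card T = a + 1"
      by (meson obtain_subset_with_card_n)
    then show ?thesis by blast
  qed
  then have "\<forall>A \<in> W - {F}. \<exists>T. T \<subseteq> A \<and> card T = a + 1 \<and> T \<inter> F \<subseteq> D"
    by simp
  then obtain T where T: "\<forall>A \<in> W - {F}. T A \<subseteq> A \<and> card (T A) = a + 1 \<and> T A \<inter> F \<subseteq> D"
    by (rule bchoice[THEN exE])
  show ?thesis
    by (rule that[of D T]) (use D T in auto)
qed

text \<open>\<open>C\<close> is a union of sets \<open>T A\<close>, which meet \<open>F\<close> only
  inside \<open>D\<close>. Later \<open>C\<close> is padded to \<open>k\<close> points outside
  \<open>\<Union>W\<close>, which leaves its intersections with members of \<open>W\<close>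
  unchanged; \<open>C \<notin> W\<close> covers the case where no padding takes place.\<close>

lemma exists_set_meeting_all_but_one:
  assumes W: "\<forall>A \<in> W. finite A \<and> card A = k" "finite W" "F \<in> W"
    and le: "card (W - {F}) * (a + 1) \<le> k" and k: "a + 2 \<le> k"
  obtains C where "C \<subseteq> \<Union>W" "card C \<le> k" "C \<notin> W" "card (C \<inter> F) \<le> a"
    "\<forall>A \<in> W - {F}. a < card (C \<inter> A)"
proof -
  let ?R = "W - {F}"
  \<comment> \<open>For \<open>r \<ge> 1\<close> one has \<open>r * (a + 1) \<ge> a + r\<close>; for
    \<open>r = 0\<close> the product says nothing about \<open>a\<close>.\<close>
  have "a + card ?R \<le> k"
  proof (cases "card ?R")
    case 0
    then show ?thesis using k by simp
  next
    case (Suc m)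
    then show ?thesis using le by simp
  qed
  then obtain D T where D: "D \<subseteq> F" "card D = a"
    and T': "\<forall>A \<in> ?R. T A \<subseteq> A \<and> card (T A) = a + 1 \<and> T A \<inter> F \<subseteq> D"
    by (rule exists_large_subsets_in_common_core[OF W])
  have T: "T A \<subseteq> A \<and> card (T A) = a + 1 \<and> T A \<inter> F \<subseteq> D" if "A \<in> ?R" for A
    using T' that by blast
  have fin: "finite D"
    using bspec[OF W(1) W(3)] D finite_subset by blast
  have sub: "\<Union>(T ` V) \<subseteq> \<Union>W" if "V \<subseteq> ?R" for V
    using that T by blast
  have size: "card (\<Union>(T ` V)) \<le> card V * (a + 1)" if "V \<subseteq> ?R" for V
  proof -
    have "finite V"
      using that W(2) finite_subset by blast
    then have "card (\<Union>(T ` V)) \<le> (\<Sum>A\<in>V. card (T A))"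
      by (rule card_UN_le)
    also have "\<dots> = card V * (a + 1)"
      using that T by (simp add: subset_iff)
    finally show ?thesis .
  qed
  have small: "card (\<Union>(T ` V) \<inter> F) \<le> a" if "V \<subseteq> ?R" for V
  proof -
    have "\<Union>(T ` V) \<inter> F \<subseteq> D"
      using that T by blast
    then show ?thesis
      using card_mono[OF fin, of "\<Union>(T ` V) \<inter> F"] D by simp
  qed
  have large: "a < card (C \<inter> A)" if "A \<in> ?R" "T A \<subseteq> C" for A C
  proof -
    have "T A \<subseteq> C \<inter> A" "finite (C \<inter> A)"
      using that T[of A] bspec[OF W(1), of A] by auto
    then show ?thesis
      using card_mono[of "C \<inter> A" "T A"] T[OF that(1)] by simp
  qed
  let ?C = "\<Union>(T ` ?R)"
  show ?thesis
  proof (cases "?C \<in> W")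
    case False
    then show ?thesis
    proof (intro that[of ?C])
      show "card ?C \<le> k"
        using size[of ?R] le by simp
      show "\<forall>A \<in> ?R. a < card (?C \<inter> A)"
        by (intro ballI large) auto
    qed (use sub small in auto)
  next
    text \<open>
      If the union of all \<open>T A\<close> happens to be a member \<open>J\<close> of \<open>W\<close>, then \<open>T J\<close> can be left out:
      any other \<open>T A\<close> already lies in \<open>J\<close>.
    \<close>
    case True
    define J where "J = ?C"
    \<comment> \<open>\<open>J\<close> is not \<open>F\<close>, because \<open>J \<inter> F\<close>
      has at most \<open>a < k\<close> points.\<close>
    have J: "J \<in> ?R"
      using True small[of ?R] bspec[OF W(1) True] k J_def by (auto simp: Int_absorb2)
    have cardJ: "card J = k"
      using J bspec[OF W(1), of J] by blast
    let ?V = "?R - {J}"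
    let ?C' = "\<Union>(T ` ?V)"
    \<comment> \<open>Leaving out \<open>T J\<close> lowers the size bound by \<open>a + 1\<close>,
      so \<open>?C'\<close> is too small to be a member of \<open>W\<close>.\<close>
    have cardV: "card ?R = Suc (card ?V)"
      using J W(2) by (intro card.remove) auto
    then have lt: "card ?C' < k"
      using size[of ?V] le by simp
    \<comment> \<open>Otherwise \<open>J\<close> would be just \<open>T J\<close>, with
      \<open>a + 1 < k\<close> points. Some other \<open>T A\<close> must remain for
      \<open>?C'\<close> to meet \<open>J\<close>.\<close>
    have "card ?V \<noteq> 0"
    proof
      assume "card ?V = 0"
      then have "card J \<le> a + 1"
        using size[of ?R] cardV by (simp add: J_def)
      then show False
        using cardJ k by simp
    qed
    then obtain A where A: "A \<in> ?V"
      by (metis card.empty ex_in_conv)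
    have "a < card (?C' \<inter> J)"
    proof -
      have "T A \<subseteq> ?C' \<inter> J"
        using A unfolding J_def by blast
      moreover have "finite (?C' \<inter> J)"
        using J bspec[OF W(1), of J] by blast
      ultimately show ?thesis
        using card_mono[of "?C' \<inter> J" "T A"] T[of A] A by auto
    qed
    moreover have "a < card (?C' \<inter> B)" if "B \<in> ?V" for B
      using that by (intro large) auto
    ultimately have "\<forall>B \<in> ?R. a < card (?C' \<inter> B)"
      by blast
    moreover have "?C' \<notin> W"
      using bspec[OF W(1), of ?C'] lt by blast
    moreover have "?C' \<subseteq> \<Union>W" "card (?C' \<inter> F) \<le> a"
      by (rule sub small, blast)+
    ultimately show ?thesis
      using that[of ?C'] lt by simp
  qed
qed

section \<open>Stalled sets of generalized Kneser graphs\<close>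

lemma pverts_gen_kneser: "pverts (gen_kneser_graph n k a) = {A. A \<subseteq> {1..n} \<and> card A = k}"
  by (simp add: gen_kneser_graph_def)

lemma parcs_gen_kneser:
  "(A, B) \<in> parcs (gen_kneser_graph n k a) \<longleftrightarrow>
     A \<in> pverts (gen_kneser_graph n k a) \<and> B \<in> pverts (gen_kneser_graph n k a) \<and>
     A \<noteq> B \<and> card (A \<inter> B) \<le> a"
  by (auto simp: gen_kneser_graph_def)

lemma card_stalled_gen_kneser:
  assumes st: "stalled (gen_kneser_graph n k a) W"
    and n: "k * (k div (a + 1) + 2) \<le> n" and k: "a + 2 \<le> k"
  shows "k div (a + 1) + 2 \<le> card W"
proof (rule ccontr)
  let ?G = "gen_kneser_graph n k a"
  assume "\<not> ?thesis"
  then have small: "card W \<le> k div (a + 1) + 1"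
    by simp
  have W: "W \<subseteq> pverts ?G" "W \<noteq> {}"
    and st': "\<And>B. B \<in> pverts ?G - W \<Longrightarrow> card {A \<in> W. (B, A) \<in> parcs ?G} \<noteq> 1"
    using st by (auto simp: stalled_def)
  have finW: "finite W"
    by (rule finite_subset[of _ "Pow {1..n}"]) (use W in \<open>auto simp: pverts_gen_kneser\<close>)
  have mem: "\<forall>A \<in> W. finite A \<and> card A = k"
    using W finite_subset[of _ "{1..n}"] by (auto simp: pverts_gen_kneser)
  have UW: "\<Union>W \<subseteq> {1..n}"
    using W by (auto simp: pverts_gen_kneser)
  then have finU: "finite (\<Union>W)"
    by (rule finite_subset) simp
  obtain F where F: "F \<in> W"
    using W by blast
  have "card (W - {F}) * (a + 1) \<le> k div (a + 1) * (a + 1)"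
    using small F finW by (intro mult_right_mono) auto
  also have "\<dots> \<le> k"
    by (rule div_times_less_eq_dividend)
  finally obtain C where C: "C \<subseteq> \<Union>W" "card C \<le> k" "C \<notin> W" "card (C \<inter> F) \<le> a"
    and hit: "\<forall>A \<in> W - {F}. a < card (C \<inter> A)"
    by (rule exists_set_meeting_all_but_one[OF mem finW F _ k])
  \<comment> \<open>At most \<open>(q + 1) * k\<close> of the at least \<open>(q + 2) * k\<close>
    points are covered by \<open>W\<close>, so \<open>k\<close> points are free for padding.\<close>
  have "card (\<Union>W) \<le> (\<Sum>A\<in>W. card A)"
    using card_UN_le[of W "\<lambda>A. A"] finW by simp
  also have "\<dots> = card W * k"
    using mem by simp
  also have "\<dots> \<le> (k div (a + 1) + 1) * k"
    using small by (rule mult_right_mono) simp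
  finally have "k \<le> n - card (\<Union>W)"
    using n by (simp add: algebra_simps)
  also have "\<dots> = card ({1..n} - \<Union>W)"
    using UW finU by (simp add: card_Diff_subset)
  finally have "k - card C \<le> card ({1..n} - \<Union>W)"
    by simp
  then obtain E where E: "E \<subseteq> {1..n} - \<Union>W" "card E = k - card C"
    by (meson obtain_subset_with_card_n)
  define B where "B = C \<union> E"
  have "finite C" "finite E"
    using C E finU finite_subset[of E "{1..n} - \<Union>W"] finite_subset by auto
  moreover have "C \<inter> E = {}"
    using C E by blast
  ultimately have "card B = k"
    using C E by (simp add: B_def card_Un_disjoint)
  then have B: "B \<in> pverts ?G"
    using C E UW by (auto simp: B_def pverts_gen_kneser)
  have BW: "B \<notin> W"
  proof
    assume "B \<in> W"
    then have "E = {}"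
      using E by (auto simp: B_def)
    then show False
      using \<open>B \<in> W\<close> C by (simp add: B_def)
  qed
  have int: "B \<inter> A = C \<inter> A" if "A \<in> W" for A
    using that E by (auto simp: B_def)
  have "{A \<in> W. (B, A) \<in> parcs ?G} = {F}"
  proof (intro equalityI subsetI)
    fix A assume "A \<in> {A \<in> W. (B, A) \<in> parcs ?G}"
    then show "A \<in> {F}"
      using bspec[OF hit, of A] int[of A] by (auto simp: parcs_gen_kneser)
  next
    fix A assume "A \<in> {F}"
    then show "A \<in> {A \<in> W. (B, A) \<in> parcs ?G}"
      using F B BW W C int[of F] by (auto simp: parcs_gen_kneser)
  qed
  then show False
    using st'[of B] B BW by simp
qed

lemma stalled_pairwise_disjoint_gen_kneser:
  assumes W: "W \<subseteq> pverts (gen_kneser_graph n k a)" and disj: "pairwise disjnt W"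
    and card: "card W = k div (a + 1) + 2"
  shows "stalled (gen_kneser_graph n k a) W"
  unfolding stalled_def
proof (intro conjI ballI)
  let ?G = "gen_kneser_graph n k a"
  show "W \<subseteq> pverts ?G" "W \<noteq> {}"
    using W card by auto
  have finW: "finite W"
    using card by (intro card_ge_0_finite) simp
  fix B assume B: "B \<in> pverts ?G - W"
  then have finB: "finite B" "card B = k"
    using finite_subset[of B "{1..n}"] by (auto simp: pverts_gen_kneser)
  define N where "N = {A \<in> W. a < card (B \<inter> A)}"
  \<comment> \<open>The traces of \<open>B\<close> on members of \<open>N\<close> are disjoint, have
    at least \<open>a + 1\<close> points each and share the \<open>k\<close> points of
    \<open>B\<close>.\<close>
  have "card N * (a + 1) \<le> (\<Sum>A\<in>N. card (B \<inter> A))"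
    using sum_bounded_below[of N "a + 1" "\<lambda>A. card (B \<inter> A)"] by (simp add: N_def)
  also have "\<dots> = card (\<Union>A\<in>N. B \<inter> A)"
    using finW finB disj
    by (intro card_UN_disjoint[symmetric]) (auto simp: N_def pairwise_def disjnt_def)
  also have "\<dots> \<le> k"
    using finB card_mono[of B "\<Union>A\<in>N. B \<inter> A"] by auto
  finally have "card N \<le> k div (a + 1)"
    by (simp add: less_eq_div_iff_mult_less_eq)
  moreover have "{A \<in> W. (B, A) \<in> parcs ?G} = W - N"
    using B W by (auto simp: N_def parcs_gen_kneser)
  moreover have "card (W - N) = card W - card N"
    using finW by (intro card_Diff_subset) (auto simp: N_def)
  ultimately show "card {A \<in> W. (B, A) \<in> parcs ?G} \<noteq> 1"
    using card by simp
qed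

lemma exists_pairwise_disjoint_subsets:
  assumes "k * m \<le> n" and "0 < k"
  obtains W :: "nat set set" where "W \<subseteq> {A. A \<subseteq> {1..n} \<and> card A = k}" "pairwise disjnt W"
    "card W = m"
proof -
  define I where "I i = {i * k + 1..i * k + k}" for i
  have disj: "disjnt (I i) (I j)" if "i < j" for i j
  proof -
    have "(i + 1) * k \<le> j * k"
      using that by (intro mult_right_mono) auto
    then show ?thesis
      by (auto simp: I_def disjnt_def)
  qed
  have disj': "disjnt (I i) (I j)" if "i \<noteq> j" for i j
    using that disj[of i j] disj[of j i] by (metis disjnt_sym linorder_neqE_nat)
  have ne: "I i \<noteq> {}" for i
    using assms by (simp add: I_def)
  \<comment> \<open>Disjoint blocks could coincide only if empty, which \<open>0 < k\<close>
    excludes.\<close>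
  have "inj I"
    using disj' ne by (metis disjnt_self_iff_empty injI)
  then have card: "card (I ` {..<m}) = m"
    by (simp add: card_image inj_on_subset)
  have "I i \<subseteq> {1..n}" if "i < m" for i
  proof -
    have "(i + 1) * k \<le> m * k"
      using that by (intro mult_right_mono) auto
    also have "\<dots> \<le> n"
      using assms by (simp add: mult.commute)
    finally show ?thesis
      by (auto simp: I_def)
  qed
  moreover have "card (I i) = k" for i
    by (simp add: I_def)
  ultimately have "I ` {..<m} \<subseteq> {A. A \<subseteq> {1..n} \<and> card A = k}"
    by blast
  moreover have "pairwise disjnt (I ` {..<m})"
    by (auto simp: pairwise_def intro!: disj')
  ultimately show ?thesis
    using card by (intro that)
qed

text \<open>Write \<open>k = q * (a + 1) + r\<close> with \<open>0 \<le> r \<le> a\<close>. Then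
  \<open>k - a\<close> exceeds \<open>q * (a + 1)\<close> by \<open>r - a\<close>, which lies above
  \<open>-(a + 1)\<close> and is at most 0.\<close>

lemma ceiling_eq_div: "\<lceil>(real k - real a) / (real a + 1)\<rceil> = int (k div (a + 1))"
proof (rule ceiling_unique)
  have "real k = real (k div (a + 1) * (a + 1) + k mod (a + 1))"
    by (simp only: div_mult_mod_eq)
  then have k: "real k = real (k div (a + 1)) * (real a + 1) + real (k mod (a + 1))"
    by (simp only: of_nat_add of_nat_mult of_nat_1)
  have "k mod (a + 1) < a + 1"
    by simp
  then have m: "real (k mod (a + 1)) \<le> real a"
    by linarith
  have "(real (k div (a + 1)) - 1) * (real a + 1) < real k - real a"
    using k by (simp add: algebra_simps)
  then show "of_int (int (k div (a + 1))) - 1 < (real k - real a) / (real a + 1)"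
    by (simp add: pos_less_divide_eq)
  have "real k - real a \<le> real (k div (a + 1)) * (real a + 1)"
    using k m by linarith
  then show "(real k - real a) / (real a + 1) \<le> of_int (int (k div (a + 1)))"
    by (simp add: pos_divide_le_eq)
qed

theorem theorem9:
  fixes n k a :: nat
  assumes "k \<le> n" and "a < k"
    and "int n \<ge> int k * (\<lceil>(real k - real a) / (real a + 1)\<rceil> + 2)"
    and "a + 2 \<le> k"
  shows "int (zero_blocking_number (gen_kneser_graph n k a))
           = \<lceil>(real k - real a) / (real a + 1)\<rceil> + 2"
proof -
  let ?G = "gen_kneser_graph n k a" and ?m = "k div (a + 1) + 2"
  have "int (k * ?m) \<le> int n"
    using assms(3) unfolding ceiling_eq_div by (simp only: of_nat_mult of_nat_add of_nat_numeral)
  then have n: "k * ?m \<le> n"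
    by (simp only: of_nat_le_iff)
  obtain W where "W \<subseteq> pverts ?G" "pairwise disjnt W" and card: "card W = ?m"
    using exists_pairwise_disjoint_subsets[OF n] assms(2) unfolding pverts_gen_kneser by auto
  then have "stalled ?G W"
    by (intro stalled_pairwise_disjoint_gen_kneser)
  moreover have "finite (pverts ?G)"
    by (simp add: pverts_gen_kneser)
  moreover have "card W \<le> card U" if "stalled ?G U" for U
    using card_stalled_gen_kneser[OF that n assms(4)] card by simp
  ultimately have "zero_blocking_number ?G = ?m"
    using zero_blocking_number_eqI[of ?G W] card by simp
  then show ?thesis
    by (simp add: ceiling_eq_div)
qed

end
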